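(* Let $F$ be a Dedekind complete and multiplicatively Archimedean totally preordered semifield with $1\ge 0$. Then $F$ is equivalent to exactly one of $\mathbb{R}_+$, $\mathbb{B}$, $\mathbb{TZ}_+$, $\mathbb{TR}_+$. Dually, if $F$ is a multiplicatively Archimedean totally preordered semifield with $1\le 0$ such that $F^{\mathrm{op}}$ is Dedekind complete, then $F$ is equivalent to exactly one of $\mathbb{R}_+^{\mathrm{op}}$, $\mathbb{B}^{\mathrm{op}}$, $\mathbb{TZ}_+^{\mathrm{op}}$, $\mathbb{TR}_+^{\mathrm{op}}$.
   Context: All structures are commutative. A semiring is a set with operations $+,\cdot$ and elements $0,1$ such that $(S,+,0)$ and $(S,\cdot,1)$ are commutative monoids, multiplication distributes over addition, and $0\cdot x=0$. A semiring homomorphism preserves $+,\cdot,0,1$. A semifield is a semiring with $1\neq 0$ in which every nonzero element is invertible; it is strict if it is not a field. A semiring preorder is a reflexive and transitive relation $\le$ such that $x\le y$ implies $a+x\le a+y$ and $ax\le ay$ for all $a,x,y$. A preordered semifield is a strict semifield $F$ with a semiring preorder such that not both $1\le 0$ and $0\le 1$. It is totally preordered if $x\le y$ or $y\le x$ for all $x,y$. Write $x<y$ for $x\le y$ and $y\not\le x$, and $x\approx y$ for $x\le y$ and $y\le x$. $F^{\mathrm{op}}$ is $F$ with the opposite preorder. $F$ is multiplicatively Archimedean if for all $x,y\in F^\times=F\setminus\{0\}$: if $x^k\le y$ for all $k\in\mathbb{N}$, then $x\le 1$. For a totally preordered semifield $F$ with $1\ge 0$, a Dedekind cut in $F$ is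 a subset $L\subseteq F$ such that (i) $L$ is downward closed; (ii) if $x\in L$, then there is $y\in L$ with $y>x$; (iii) $L\neq F$. For $x\in F$ put $L_x:=\{y\in F\mid y<x\}$. $F$ is Dedekind complete if every Dedekind cut is equal to $L_x$ for some $x\in F$. $F$ is equivalent to $K$ if there is a monotone semiring homomorphism $f:F\to K$ that is an order embedding ($x\le y\Leftrightarrow f(x)\le f(y)$) and such that for every $y\in K$ there is $x\in F$ with $f(x)\approx y$ (equivalently, $f$ induces an isomorphism of partially ordered semirings $F/{\approx}\to K/{\approx}$). $\mathbb{R}_+$: nonnegative reals with usual operations and order. $\mathbb{B}=\{0,1\}$ with $1+1=1$ and $0\le 1$. $\mathbb{TZ}_+=(\mathbb{Z}\cup\{-\infty\},\max,+)$, i.e. semiring addition is $\max$, semiring multiplication is $+$, zero is $-\infty$, unit is $0$, with the usual order. $\mathbb{TR}_+$: nonnegative reals with $\max$ as addition, usual multiplication and usual order. *)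

theory Defs
  imports Complex_Main
begin

text \<open>
  Semirings are types of class \<^class>\<open>comm_semiring_1\<close>, which includes \<open>0 \<noteq> 1\<close>.  The preorder is
  an explicit relation rather than a class operation, so that the opposite of a preordered
  semifield with relation \<open>le\<close> is the same type with relation \<open>le\<inverse>\<inverse>\<close>.
\<close>

definition strict_of :: "('a \<Rightarrow> 'a \<Rightarrow> bool) \<Rightarrow> 'a \<Rightarrow> 'a \<Rightarrow> bool" where
  "strict_of le x y \<longleftrightarrow> le x y \<and> \<not> le y x"

definition equiv_of :: "('a \<Rightarrow> 'a \<Rightarrow> bool) \<Rightarrow> 'a \<Rightarrow> 'a \<Rightarrow> bool" where
  "equiv_of le x y \<longleftrightarrow> le x y \<and> le y x"

locale preordered_semifield =
  fixes le :: "'a::comm_semiring_1 \<Rightarrow> 'a \<Rightarrow> bool"  (infix "\<preceq>" 50)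
  assumes inverse_exists: "x \<noteq> 0 \<Longrightarrow> \<exists>y. x * y = 1"
    and not_field: "\<not> (\<forall>x::'a. \<exists>y. x + y = 0)"
    and reflp_le: "reflp (\<preceq>)"
    and transp_le: "transp (\<preceq>)"
    and add_mono: "x \<preceq> y \<Longrightarrow> a + x \<preceq> a + y"
    and mult_mono: "x \<preceq> y \<Longrightarrow> a * x \<preceq> a * y"
    and one_zero_not_equiv: "\<not> (1 \<preceq> 0 \<and> 0 \<preceq> 1)"

locale totally_preordered_semifield = preordered_semifield +
  assumes total: "x \<preceq> y \<or> y \<preceq> x"

definition mult_archimedean :: "('a::comm_semiring_1 \<Rightarrow> 'a \<Rightarrow> bool) \<Rightarrow> bool" where
  "mult_archimedean le \<longleftrightarrow>
     (\<forall>x y. x \<noteq> 0 \<longrightarrow> y \<noteq> 0 \<longrightarrow> (\<forall>k::nat. le (x ^ k) y) \<longrightarrow> le x 1)"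

definition dedekind_cut :: "('a \<Rightarrow> 'a \<Rightarrow> bool) \<Rightarrow> 'a set \<Rightarrow> bool" where
  "dedekind_cut le L \<longleftrightarrow>
     (\<forall>x\<in>L. \<forall>y. le y x \<longrightarrow> y \<in> L) \<and>
     (\<forall>x\<in>L. \<exists>y\<in>L. strict_of le x y) \<and>
     L \<noteq> UNIV"

definition dedekind_complete :: "('a \<Rightarrow> 'a \<Rightarrow> bool) \<Rightarrow> bool" where
  "dedekind_complete le \<longleftrightarrow>
     (\<forall>L. dedekind_cut le L \<longrightarrow> (\<exists>x. L = {y. strict_of le y x}))"

definition semiring_hom :: "('a::comm_semiring_1 \<Rightarrow> 'b::comm_semiring_1) \<Rightarrow> bool" where
  "semiring_hom f \<longleftrightarrow> f 0 = 0 \<and> f 1 = 1 \<and>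
     (\<forall>x y. f (x + y) = f x + f y) \<and> (\<forall>x y. f (x * y) = f x * f y)"

definition equivalent_to ::
  "('a::comm_semiring_1 \<Rightarrow> 'a \<Rightarrow> bool) \<Rightarrow> ('b::comm_semiring_1 \<Rightarrow> 'b \<Rightarrow> bool) \<Rightarrow> bool" where
  "equivalent_to leF leK \<longleftrightarrow>
     (\<exists>f. semiring_hom f \<and> monotone leF leK f \<and>
          (\<forall>x y. leF x y \<longleftrightarrow> leK (f x) (f y)) \<and>
          (\<forall>y. \<exists>x. equiv_of leK (f x) y))"

definition exactly_one :: "bool list \<Rightarrow> bool" where
  "exactly_one Ps \<longleftrightarrow> (\<exists>!i. i < length Ps \<and> Ps ! i)"

typedef nnreal = "{x::real. 0 \<le> x}"
  morphisms real_of_nnreal Abs_nnreal by auto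

setup_lifting type_definition_nnreal

instantiation nnreal :: linorder
begin
lift_definition less_eq_nnreal :: "nnreal \<Rightarrow> nnreal \<Rightarrow> bool" is "(\<le>)" .
lift_definition less_nnreal :: "nnreal \<Rightarrow> nnreal \<Rightarrow> bool" is "(<)" .
instance by standard (transfer; force)+
end

instantiation nnreal :: comm_semiring_1
begin
lift_definition zero_nnreal :: nnreal is 0 by simp
lift_definition one_nnreal :: nnreal is 1 by simp
lift_definition plus_nnreal :: "nnreal \<Rightarrow> nnreal \<Rightarrow> nnreal" is "(+)" by simp
lift_definition times_nnreal :: "nnreal \<Rightarrow> nnreal \<Rightarrow> nnreal" is "(*)" by simp
instance by standard (transfer; simp add: algebra_simps)+
end

datatype boolsf = BZero | BOne

instantiation boolsf :: linorder
begin
definition less_eq_boolsf :: "boolsf \<Rightarrow> boolsf \<Rightarrow> bool" where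
  "x \<le> y \<longleftrightarrow> x = BZero \<or> y = BOne"
definition less_boolsf :: "boolsf \<Rightarrow> boolsf \<Rightarrow> bool" where
  "x < y \<longleftrightarrow> x = BZero \<and> y = BOne"
instance
  by standard (auto simp: less_eq_boolsf_def less_boolsf_def, (metis boolsf.exhaust)+)
end

instantiation boolsf :: comm_semiring_1
begin
definition zero_boolsf :: boolsf where "0 = BZero"
definition one_boolsf :: boolsf where "1 = BOne"
definition plus_boolsf :: "boolsf \<Rightarrow> boolsf \<Rightarrow> boolsf" where
  "x + y = (if x = BOne \<or> y = BOne then BOne else BZero)"
definition times_boolsf :: "boolsf \<Rightarrow> boolsf \<Rightarrow> boolsf" where
  "x * y = (if x = BOne \<and> y = BOne then BOne else BZero)"
instance
proof
  fix x y z :: boolsf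
  note defs = zero_boolsf_def one_boolsf_def plus_boolsf_def times_boolsf_def
  show "x + y + z = x + (y + z)" by (simp add: defs)
  show "x + y = y + x" by (simp add: defs)
  show "0 + x = x" by (cases x) (simp_all add: defs)
  show "x * y * z = x * (y * z)" by (simp add: defs)
  show "x * y = y * x" by (simp add: defs)
  show "1 * x = x" by (cases x) (simp_all add: defs)
  show "0 * x = 0" by (simp add: defs)
  show "x * 0 = 0" by (simp add: defs)
  show "(x + y) * z = x * z + y * z" by (simp add: defs)
  show "(0::boolsf) \<noteq> 1" by (simp add: defs)
qed
end

text \<open>\<open>MInf\<close> is \<open>-\<infinity>\<close>; semiring addition is the maximum and multiplication is integer addition.\<close>

datatype trop_int = MInf | Trop int

instantiation trop_int :: linorder
begin
fun less_eq_trop_int :: "trop_int \<Rightarrow> trop_int \<Rightarrow> bool" where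
  "less_eq_trop_int MInf y = True"
| "less_eq_trop_int (Trop m) MInf = False"
| "less_eq_trop_int (Trop m) (Trop n) = (m \<le> n)"
definition less_trop_int :: "trop_int \<Rightarrow> trop_int \<Rightarrow> bool" where
  "less_trop_int x y \<longleftrightarrow> x \<le> y \<and> \<not> y \<le> x"
instance
proof
  fix x y z :: trop_int
  show "x < y \<longleftrightarrow> x \<le> y \<and> \<not> y \<le> x" by (rule less_trop_int_def)
  show "x \<le> x" by (cases x) auto
  show "x \<le> y \<Longrightarrow> y \<le> z \<Longrightarrow> x \<le> z" by (cases x; cases y; cases z) auto
  show "x \<le> y \<Longrightarrow> y \<le> x \<Longrightarrow> x = y" by (cases x; cases y) auto
  show "x \<le> y \<or> y \<le> x" by (cases x; cases y) auto
qed
end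

instantiation trop_int :: comm_semiring_1
begin
definition zero_trop_int :: trop_int where "0 = MInf"
definition one_trop_int :: trop_int where "1 = Trop 0"
definition plus_trop_int :: "trop_int \<Rightarrow> trop_int \<Rightarrow> trop_int" where
  "plus_trop_int x y = max x y"
fun times_trop_int :: "trop_int \<Rightarrow> trop_int \<Rightarrow> trop_int" where
  "times_trop_int MInf y = MInf"
| "times_trop_int (Trop m) MInf = MInf"
| "times_trop_int (Trop m) (Trop n) = Trop (m + n)"
instance
proof
  fix x y z :: trop_int
  show "x + y + z = x + (y + z)" by (simp add: plus_trop_int_def max.assoc)
  show "x + y = y + x" by (simp add: plus_trop_int_def max.commute)
  show "0 + x = x" by (simp add: plus_trop_int_def zero_trop_int_def max_def)
  show "x * y * z = x * (y * z)" by (cases x; cases y; cases z) auto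
  show "x * y = y * x" by (cases x; cases y) auto
  show "1 * x = x" by (cases x) (auto simp: one_trop_int_def)
  show "0 * x = 0" by (simp add: zero_trop_int_def)
  show "x * 0 = 0" by (cases x) (auto simp: zero_trop_int_def)
  show "(x + y) * z = x * z + y * z"
    by (cases x; cases y; cases z) (auto simp: plus_trop_int_def max_def)
  show "(0::trop_int) \<noteq> 1" by (simp add: zero_trop_int_def one_trop_int_def)
qed
end

text \<open>Nonnegative reals with maximum as addition and the usual multiplication.\<close>

typedef trop_real = "{x::real. 0 \<le> x}"
  morphisms real_of_trop_real Abs_trop_real by auto

setup_lifting type_definition_trop_real

instantiation trop_real :: linorder
begin
lift_definition less_eq_trop_real :: "trop_real \<Rightarrow> trop_real \<Rightarrow> bool" is "(\<le>)" .
lift_definition less_trop_real :: "trop_real \<Rightarrow> trop_real \<Rightarrow> bool" is "(<)" .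
instance by standard (transfer; force)+
end

instantiation trop_real :: comm_semiring_1
begin
lift_definition zero_trop_real :: trop_real is 0 by simp
lift_definition one_trop_real :: trop_real is 1 by simp
lift_definition plus_trop_real :: "trop_real \<Rightarrow> trop_real \<Rightarrow> trop_real" is max by simp
lift_definition times_trop_real :: "trop_real \<Rightarrow> trop_real \<Rightarrow> trop_real" is "(*)" by simp
instance
proof
  fix x y z :: trop_real
  show "x + y + z = x + (y + z)" by transfer (rule max.assoc)
  show "x + y = y + x" by transfer (rule max.commute)
  show "0 + x = x" by transfer simp
  show "x * y * z = x * (y * z)" by transfer (rule mult.assoc)
  show "x * y = y * x" by transfer (rule mult.commute)
  show "1 * x = x" by transfer simp
  show "0 * x = 0" by transfer simp
  show "x * 0 = 0" by transfer simp
  show "(x + y) * z = x * z + y * z" by transfer (simp add: max_mult_distrib_right)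
  show "(0::trop_real) \<noteq> 1" by transfer simp
qed
end

end

theory Submission imports Defs begin

text \<open>
  The idea is that everything except addition is governed by Hoelder's theorem on Archimedean
  ordered groups, and that the value of \<open>1 + 1\<close> then decides what addition is.

  Let \<open>0 \<le> 1\<close>. The nonzero elements modulo equivalence form an Archimedean totally ordered group.
  If no element lies above \<open>1\<close>, only the classes of \<open>0\<close> and \<open>1\<close> remain and the model is
  \<open>boolsf\<close>. Otherwise any chosen \<open>b\<close> above \<open>1\<close> serves as the base of a logarithm,
  and \<open>2 powr\<close> of that logarithm is a multiplicative order embedding \<open>g\<close> into \<open>[0, \<infinity>)\<close> with
  \<open>g b = 2\<close> (\<open>hoelder\<close>). The freedom in \<open>b\<close> lets each case normalise \<open>g\<close> conveniently.

  If \<open>1 + 1\<close> is equivalent to \<open>1\<close>, then addition is the maximum up to equivalence. Either there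
  is a least element \<open>b\<close> above \<open>1\<close>, and with this base the nonzero values of \<open>g\<close> are exactly the
  integral powers of \<open>2\<close>, which is \<open>trop_int\<close>; or there is none, the values of \<open>g\<close> come
  arbitrarily close to \<open>1\<close> from above, hence are dense, and Dedekind completeness fills all of
  \<open>[0, \<infinity>)\<close>, which is \<open>trop_real\<close>.

  If \<open>1 + 1\<close> is strictly above \<open>1\<close>, it is itself taken as base. The natural numbers sit in the
  semifield with their usual order, so \<open>g\<close> is a monotone multiplicative function on them with
  \<open>g 2 = 2\<close>, and this forces \<open>g n = n\<close> (\<open>g_of_nat\<close>). Squeezing between rationals makes \<open>g\<close>
  additive (\<open>g_add\<close>); its values contain the nonnegative rationals, so they are dense and
  completeness gives \<open>nnreal\<close>.

  The models are told apart by whether \<open>1 + 1 \<le> 1\<close>, whether something lies above \<open>1\<close>, and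
  whether there is a least such element; all three properties survive equivalence. The case
  \<open>1 \<le> 0\<close> is the first case for the opposite preorder.
\<close>

section \<open>Preliminaries\<close>

text \<open>Rationals in the form in which they occur as exponents below.\<close>

lemma rational_between:
  fixes r s :: real
  assumes "r < s"
  obtains i j n :: nat where "n > 0" "r < (real i - real j) / real n" "(real i - real j) / real n < s"
proof -
  obtain q where q: "q \<in> \<rat>" "r < q" "q < s" using Rats_dense_in_real[OF assms] by blast
  from q(1) obtain m :: int and n :: nat where n: "n > 0" "q = real_of_int m / real n"
    unfolding Rats_eq_int_div_nat by blast
  have "q = (real (nat m) - real (nat (- m))) / real n" unfolding n(2) by (cases "m \<ge> 0") simp_all
  then show ?thesis using that[OF n(1), of "nat m" "nat (- m)"] q by simp
qed

text \<open>Used to upgrade an estimate with a bounded rounding error to an equation: the error stays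
  fixed while the two sides are scaled up.\<close>

lemma eq_of_bounded_multiples:
  fixes a c :: real
  assumes "\<And>n::nat. n > 0 \<Longrightarrow> real n * a \<le> real n * c + K" and "\<And>n::nat. n > 0 \<Longrightarrow> real n * c \<le> real n * a + K"
  shows "a = c"
proof -
  have *: "u \<le> v" if "\<And>n::nat. n > 0 \<Longrightarrow> real n * u \<le> real n * v + K" for u v :: real
  proof (rule ccontr)
    assume "\<not> u \<le> v"
    then have "u - v > 0" by simp
    then obtain n where n: "\<bar>K\<bar> < real n * (u - v)" using reals_Archimedean3 by blast
    then have "n > 0" by (cases n) auto
    then show False using that[of n] n unfolding right_diff_distrib by linarith
  qed
  show ?thesis by (rule antisym[OF *[OF assms(1)] *[OF assms(2)]])
qed

lemma equivalent_toI:
  fixes f :: "'a::comm_semiring_1 \<Rightarrow> 'b::{comm_semiring_1, order}"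
  assumes "semiring_hom f" and "\<And>y. \<exists>x. f x = y" and "\<And>x y. leF x y \<longleftrightarrow> f x \<le> f y"
  shows "equivalent_to leF ((\<le>) :: 'b \<Rightarrow> _)"
proof -
  have "monotone leF (\<le>) f" using assms(3) by (simp add: monotone_def)
  moreover have "\<exists>x. equiv_of (\<le>) (f x) y" for y
    using assms(2)[of y] by (auto simp: equiv_of_def)
  ultimately show ?thesis using assms(1,3) unfolding equivalent_to_def by blast
qed


section \<open>Multiplicatively Archimedean semifields\<close>

locale archimedean_semifield = totally_preordered_semifield +
  assumes zero_le_one: "0 \<preceq> 1"
    and archimedean: "mult_archimedean (\<preceq>)"
begin

lemma le_refl [simp]: "x \<preceq> x"
  using reflp_le by (simp add: reflpD)

lemma le_trans [trans]: "x \<preceq> y \<Longrightarrow> y \<preceq> z \<Longrightarrow> x \<preceq> z"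
  using transp_le by (meson transpD)

lemma add_mono_both: "x \<preceq> y \<Longrightarrow> u \<preceq> v \<Longrightarrow> x + u \<preceq> y + v"
  by (metis add.commute add_mono le_trans)

lemma mult_mono_both: "x \<preceq> y \<Longrightarrow> u \<preceq> v \<Longrightarrow> x * u \<preceq> y * v"
  by (metis mult.commute mult_mono le_trans)

lemma power_mono: "x \<preceq> y \<Longrightarrow> x ^ n \<preceq> y ^ n"
  by (induction n) (auto intro: mult_mono_both)

lemma zero_le: "0 \<preceq> x"
  using mult_mono[OF zero_le_one, of x] by simp

lemma le_add: "x \<preceq> x + y"
  using add_mono[OF zero_le, of x y] by simp

lemma not_le_zero: "x \<noteq> 0 \<Longrightarrow> \<not> x \<preceq> 0"
proof
  assume "x \<noteq> 0" "x \<preceq> 0"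
  then obtain y where "x * y = 1" using inverse_exists by blast
  then have "1 \<preceq> 0" using mult_mono[OF \<open>x \<preceq> 0\<close>, of y] by (simp add: mult.commute)
  then show False using zero_le_one one_zero_not_equiv by blast
qed

lemma mult_eq_0: "x * y = 0 \<longleftrightarrow> x = 0 \<or> y = (0::'a)"
proof
  assume "x * y = 0"
  show "x = 0 \<or> y = 0"
  proof (rule ccontr)
    assume "\<not> (x = 0 \<or> y = 0)"
    then obtain x' where "x * x' = 1" using inverse_exists by blast
    then have "y = x' * (x * y)" by (metis mult.assoc mult.commute mult_1)
    then show False using \<open>x * y = 0\<close> \<open>\<not> (x = 0 \<or> y = 0)\<close> by simp
  qed
qed auto

lemma power_nonzero: "x \<noteq> 0 \<Longrightarrow> x ^ n \<noteq> (0::'a)"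
  by (induction n) (auto simp: mult_eq_0)

lemma mult_le_cancel: "z \<noteq> 0 \<Longrightarrow> z * x \<preceq> z * y \<longleftrightarrow> x \<preceq> y"
proof
  assume "z \<noteq> 0" "z * x \<preceq> z * y"
  then obtain z' where z': "z * z' = 1" using inverse_exists by blast
  have "z' * (z * u) = u" for u
    using z' by (metis mult.assoc mult.commute mult_1)
  then show "x \<preceq> y" using mult_mono[OF \<open>z * x \<preceq> z * y\<close>, of z'] by simp
qed (rule mult_mono)

lemma power_above:
  assumes "\<not> x \<preceq> 1" "y \<noteq> 0"
  obtains k where "y \<preceq> x ^ k"
proof -
  have "x \<noteq> 0" using assms(1) zero_le by auto
  then obtain k where "\<not> x ^ k \<preceq> y"
    using archimedean assms unfolding mult_archimedean_def by blast
  then show ?thesis using total that by blast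
qed

lemma power_le_power_iff:
  assumes "\<not> b \<preceq> 1"
  shows "b ^ i \<preceq> b ^ j \<longleftrightarrow> i \<le> j"
proof -
  have b: "b \<noteq> 0" "1 \<preceq> b" using assms zero_le total by auto
  have ge: "1 \<preceq> b ^ k" for k using power_mono[OF b(2), of k] by simp
  show ?thesis
  proof
    assume "i \<le> j"
    then have "b ^ j = b ^ i * b ^ (j - i)" by (simp flip: power_add)
    then show "b ^ i \<preceq> b ^ j" using mult_mono[OF ge, of "b ^ i" "j - i"] by simp
  next
    assume le: "b ^ i \<preceq> b ^ j"
    show "i \<le> j"
    proof (rule ccontr)
      assume "\<not> i \<le> j"
      then have "i = j + Suc (i - j - 1)" by simp
      then have "b ^ i = b ^ j * (b * b ^ (i - j - 1))"
        by (metis power_add power_Suc)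
      then have "b * b ^ (i - j - 1) \<preceq> 1"
        using le mult_le_cancel[OF power_nonzero[OF b(1)], of j _ 1] by simp
      then have "b \<preceq> 1" using mult_mono[OF ge, of b "i - j - 1"] le_trans by simp
      then show False using assms by simp
    qed
  qed
qed

text \<open>A single coincidence \<open>j + 1 \<preceq> j\<close> would propagate to \<open>2 j \<preceq> j\<close>, and then \<open>1 + 1 \<preceq> 1\<close>.\<close>

lemma of_nat_le_iff_non_idempotent:
  assumes two: "\<not> 1 + 1 \<preceq> 1"
  shows "of_nat i \<preceq> of_nat j \<longleftrightarrow> i \<le> j"
proof
  assume "i \<le> j"
  then show "of_nat i \<preceq> of_nat j" using le_add[of "of_nat i" "of_nat (j - i)"] by (simp flip: of_nat_add)
next
  assume le: "of_nat i \<preceq> of_nat j"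
  show "i \<le> j"
  proof (rule ccontr)
    assume "\<not> i \<le> j"
    then have "of_nat (Suc j) \<preceq> of_nat i"
      using le_add[of "of_nat (Suc j)" "of_nat (i - Suc j)"] by (simp flip: of_nat_add of_nat_Suc)
    then have step: "of_nat (Suc j) \<preceq> of_nat j" using le le_trans by blast
    have all: "of_nat (j + k) \<preceq> of_nat j" for k
    proof (induction k)
      case (Suc k)
      have "of_nat (j + Suc k) = of_nat k + of_nat (Suc j)" by (simp add: ac_simps)
      also have "\<dots> \<preceq> of_nat k + of_nat j" by (rule add_mono[OF step])
      also have "\<dots> = of_nat (j + k)" by (simp add: ac_simps)
      also have "\<dots> \<preceq> of_nat j" by (rule Suc.IH)
      finally show ?case .
    qed simp
    have "j \<noteq> 0" using step not_le_zero[of 1] by (cases j) auto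
    then have "1 \<preceq> of_nat j" using le_add[of 1 "of_nat (j - 1)"] by (cases j) auto
    then have "of_nat j \<noteq> (0::'a)" using not_le_zero[of 1] by auto
    moreover have "of_nat j * (1 + 1) \<preceq> of_nat j * 1" using all[of j] by (simp only: of_nat_add distrib_left mult_1_right)
    ultimately show False using two mult_le_cancel by blast
  qed
qed


section \<open>Hoelder's embedding\<close>

text \<open>The rational exponents \<open>r\<close> for which \<open>b powr r\<close> is at most \<open>x\<close>. Writing \<open>r\<close> as
  \<open>(i - j) / n\<close> with natural \<open>i\<close>, \<open>j\<close> and clearing denominators states this with powers alone,
  since inverses are not an operation of the semiring and roots may not exist.\<close>

definition exponents_below :: "'a \<Rightarrow> 'a \<Rightarrow> real set" where
  "exponents_below b x =
     {r. \<exists>i j n. n > 0 \<and> r = (real i - real j) / real n \<and> b ^ i \<preceq> b ^ j * x ^ n}"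

lemma exponents_belowI:
  "n > 0 \<Longrightarrow> b ^ i \<preceq> b ^ j * x ^ n \<Longrightarrow> (real i - real j) / real n \<in> exponents_below b x"
  unfolding exponents_below_def by blast

lemma exponents_belowE:
  assumes "r \<in> exponents_below b x"
  obtains i j n where "n > 0" "r = (real i - real j) / real n" "b ^ i \<preceq> b ^ j * x ^ n"
  using assms unfolding exponents_below_def by blast

definition logarithm :: "'a \<Rightarrow> 'a \<Rightarrow> real" where
  "logarithm b x = Sup (exponents_below b x)"

context
  fixes b :: 'a
  assumes b_gt_one: "\<not> b \<preceq> 1"
begin

lemma base_nonzero: "b \<noteq> 0"
  using b_gt_one zero_le by auto

text \<open>Raising both comparisons to a common power of \<open>x\<close> and eliminating it leaves a comparison
  of powers of \<open>b\<close>.\<close>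

lemma exponent_below_le_above:
  assumes n: "n > 0" and m: "m > 0"
    and lower: "b ^ i \<preceq> b ^ j * x ^ n"
    and upper: "b ^ l * x ^ m \<preceq> b ^ k"
  shows "(real i - real j) / real n \<le> (real k - real l) / real m"
proof -
  have 1: "b ^ (i * m) \<preceq> b ^ (j * m) * x ^ (n * m)"
    using power_mono[OF lower, of m] by (simp add: power_mult power_mult_distrib)
  have 2: "b ^ (l * n) * x ^ (n * m) \<preceq> b ^ (k * n)"
    using power_mono[OF upper, of n]
    by (simp add: power_mult power_mult_distrib mult.commute[of n m])
  have "b ^ (l * n) * b ^ (i * m) \<preceq> b ^ (l * n) * (b ^ (j * m) * x ^ (n * m))"
    using 1 by (rule mult_mono)
  also have "\<dots> = b ^ (j * m) * (b ^ (l * n) * x ^ (n * m))" by (simp add: ac_simps)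
  also have "\<dots> \<preceq> b ^ (j * m) * b ^ (k * n)" using 2 by (rule mult_mono)
  finally have "l * n + i * m \<le> j * m + k * n"
    by (simp add: power_le_power_iff[OF b_gt_one] flip: power_add)
  then have "real l * n + real i * m \<le> real j * m + real k * n"
    by (metis of_nat_add of_nat_mult of_nat_le_iff)
  then show ?thesis using n m by (simp add: field_simps)
qed

lemma exponent_above_exists:
  assumes "x \<noteq> 0"
  obtains k where "x \<preceq> b ^ k"
  using power_above[OF b_gt_one assms] .

lemma exponent_below_exists:
  assumes "x \<noteq> 0"
  obtains k where "1 \<preceq> b ^ k * x"
proof -
  obtain y where y: "x * y = 1" using inverse_exists assms by blast
  then have "y \<noteq> 0" by auto
  then obtain k where "y \<preceq> b ^ k" by (rule exponent_above_exists)
  then have "x * y \<preceq> x * b ^ k" by (rule mult_mono)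
  then have "1 \<preceq> b ^ k * x" unfolding y mult.commute[of x "b ^ k"] .
  then show ?thesis by (rule that)
qed

lemma logarithm_ge:
  assumes "x \<noteq> 0" "n > 0" "b ^ i \<preceq> b ^ j * x ^ n"
  shows "(real i - real j) / real n \<le> logarithm b x"
proof -
  obtain k where k: "x \<preceq> b ^ k" using exponent_above_exists assms(1) .
  have "r \<le> real k" if mem: "r \<in> exponents_below b x" for r
  proof -
    obtain i j n where r: "n > 0" "r = (real i - real j) / real n" "b ^ i \<preceq> b ^ j * x ^ n"
      using mem by (rule exponents_belowE)
    have "b ^ 0 * x ^ 1 \<preceq> b ^ k" using k by simp
    from exponent_below_le_above[OF r(1) _ r(3) this] r(2) show ?thesis by simp
  qed
  then have "bdd_above (exponents_below b x)" by (rule bdd_aboveI)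
  moreover have "(real i - real j) / real n \<in> exponents_below b x"
    using exponents_belowI[OF assms(2,3)] .
  ultimately show ?thesis unfolding logarithm_def by (simp add: cSup_upper)
qed

lemma logarithm_le:
  assumes "x \<noteq> 0" "n > 0" "b ^ j * x ^ n \<preceq> b ^ i"
  shows "logarithm b x \<le> (real i - real j) / real n"
proof -
  obtain k where k: "1 \<preceq> b ^ k * x" using exponent_below_exists assms(1) .
  then have "(real 0 - real k) / real 1 \<in> exponents_below b x"
    using exponents_belowI[of 1 b 0 k x] by simp
  then have "exponents_below b x \<noteq> {}" by blast
  then show ?thesis
    unfolding logarithm_def
  proof (rule cSup_least)
    fix r assume "r \<in> exponents_below b x"
    then obtain i' j' n' where r: "n' > 0" "r = (real i' - real j') / real n'"
        "b ^ i' \<preceq> b ^ j' * x ^ n'"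
      by (rule exponents_belowE)
    show "r \<le> (real i - real j) / real n"
      unfolding r(2) using exponent_below_le_above[OF r(1) assms(2) r(3) assms(3)] .
  qed
qed

lemma exponent_below:
  assumes "x \<noteq> 0" "r < logarithm b x"
  obtains i j n where "n > 0" "r < (real i - real j) / real n" "b ^ i \<preceq> b ^ j * x ^ n"
proof -
  obtain i j n :: nat where *: "n > 0" "r < (real i - real j) / real n"
      "(real i - real j) / real n < logarithm b x"
    using rational_between[OF assms(2)] .
  then have "b ^ i \<preceq> b ^ j * x ^ n"
    using logarithm_le[OF assms(1) *(1), of j i] total by force
  then show ?thesis using that * by blast
qed

lemma exponent_above:
  assumes "x \<noteq> 0" "logarithm b x < r"
  obtains i j n where "n > 0" "(real i - real j) / real n < r" "b ^ j * x ^ n \<preceq> b ^ i"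
proof -
  obtain i j n :: nat where *: "n > 0" "logarithm b x < (real i - real j) / real n"
      "(real i - real j) / real n < r"
    using rational_between[OF assms(2)] .
  then have "b ^ j * x ^ n \<preceq> b ^ i"
    using logarithm_ge[OF assms(1) *(1), of i j] total * by (meson not_less)
  then show ?thesis using that * by blast
qed

text \<open>Rational bounds for the two logarithms, brought to the common denominator \<open>n * m\<close>, multiply
  to a rational bound for the product.\<close>

lemma logarithm_mult:
  assumes x: "x \<noteq> 0" and y: "y \<noteq> 0"
  shows "logarithm b (x * y) = logarithm b x + logarithm b y"
proof (rule antisym)
  have xy: "x * y \<noteq> 0" using x y by (simp add: mult_eq_0)
  show "logarithm b x + logarithm b y \<le> logarithm b (x * y)"
  proof (rule field_le_epsilon)
    fix e :: real assume "e > 0"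
    then have less: "logarithm b x - e / 2 < logarithm b x" "logarithm b y - e / 2 < logarithm b y"
      by auto
    obtain i j n where
        1: "n > 0" "logarithm b x - e / 2 < (real i - real j) / real n" "b ^ i \<preceq> b ^ j * x ^ n"
      using exponent_below[OF x less(1)] .
    obtain k l m where
        2: "m > 0" "logarithm b y - e / 2 < (real k - real l) / real m" "b ^ k \<preceq> b ^ l * y ^ m"
      using exponent_below[OF y less(2)] .
    have "b ^ (i * m) * b ^ (k * n) \<preceq> b ^ (j * m) * x ^ (n * m) * (b ^ (l * n) * y ^ (m * n))"
      using mult_mono_both[OF power_mono[OF 1(3), of m] power_mono[OF 2(3), of n]]
      by (simp only: power_mult power_mult_distrib)
    then have "b ^ (i * m + k * n) \<preceq> b ^ (j * m + l * n) * (x * y) ^ (n * m)"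
      by (simp add: power_mult_distrib power_add ac_simps)
    from logarithm_ge[OF xy _ this] 1(1) 2(1)
    have "(real (i * m + k * n) - real (j * m + l * n)) / real (n * m) \<le> logarithm b (x * y)"
      by simp
    moreover have "(real (i * m + k * n) - real (j * m + l * n)) / real (n * m) =
        (real i - real j) / real n + (real k - real l) / real m"
      using 1(1) 2(1) by (simp add: field_simps)
    ultimately have "(real i - real j) / real n + (real k - real l) / real m \<le> logarithm b (x * y)"
      by simp
    then show "logarithm b x + logarithm b y \<le> logarithm b (x * y) + e" using 1 2 by linarith
  qed
  show "logarithm b (x * y) \<le> logarithm b x + logarithm b y"
  proof (rule field_le_epsilon)
    fix e :: real assume "e > 0"
    then have less: "logarithm b x < logarithm b x + e / 2" "logarithm b y < logarithm b y + e / 2"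
      by auto
    obtain i j n where
        1: "n > 0" "(real i - real j) / real n < logarithm b x + e / 2" "b ^ j * x ^ n \<preceq> b ^ i"
      using exponent_above[OF x less(1)] .
    obtain k l m where
        2: "m > 0" "(real k - real l) / real m < logarithm b y + e / 2" "b ^ l * y ^ m \<preceq> b ^ k"
      using exponent_above[OF y less(2)] .
    have "b ^ (j * m) * x ^ (n * m) * (b ^ (l * n) * y ^ (m * n)) \<preceq> b ^ (i * m) * b ^ (k * n)"
      using mult_mono_both[OF power_mono[OF 1(3), of m] power_mono[OF 2(3), of n]]
      by (simp only: power_mult power_mult_distrib)
    then have "b ^ (j * m + l * n) * (x * y) ^ (n * m) \<preceq> b ^ (i * m + k * n)"
      by (simp add: power_mult_distrib power_add ac_simps)
    from logarithm_le[OF xy _ this] 1(1) 2(1)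
    have "logarithm b (x * y) \<le> (real (i * m + k * n) - real (j * m + l * n)) / real (n * m)"
      by simp
    moreover have "(real (i * m + k * n) - real (j * m + l * n)) / real (n * m) =
        (real i - real j) / real n + (real k - real l) / real m"
      using 1(1) 2(1) by (simp add: field_simps)
    ultimately have "logarithm b (x * y) \<le> (real i - real j) / real n + (real k - real l) / real m"
      by simp
    then show "logarithm b (x * y) \<le> logarithm b x + logarithm b y + e" using 1 2 by linarith
  qed
qed

lemma logarithm_base: "logarithm b b = 1"
proof (rule antisym)
  show "logarithm b b \<le> 1"
    using logarithm_le[OF base_nonzero, of 1 0 1] by simp
  show "1 \<le> logarithm b b"
    using logarithm_ge[OF base_nonzero, of 1 1 0] by simp
qed

lemma logarithm_one: "logarithm b 1 = 0"
  using logarithm_mult[of 1 1] by simp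

text \<open>This is where injectivity up to equivalence comes from: an element strictly above \<open>1\<close>
  has a power above \<open>b\<close>.\<close>

lemma logarithm_pos:
  assumes "\<not> z \<preceq> 1"
  shows "logarithm b z > 0"
proof -
  have z: "z \<noteq> 0" using assms zero_le by auto
  obtain k where k: "b \<preceq> z ^ k" using power_above[OF assms base_nonzero] .
  have "k > 0" using k b_gt_one by (cases k) auto
  then have "(real 1 - real 0) / real k \<le> logarithm b z"
    using logarithm_ge[OF z, of k 1 0] k by simp
  moreover have "(real 1 - real 0) / real k > 0" using \<open>k > 0\<close> by simp
  ultimately show ?thesis by linarith
qed

lemma logarithm_le_iff:
  assumes x: "x \<noteq> 0" and y: "y \<noteq> 0"
  shows "logarithm b x \<le> logarithm b y \<longleftrightarrow> x \<preceq> y"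
proof -
  have strict: "logarithm b u < logarithm b v" if "u \<noteq> 0" "v \<noteq> 0" "\<not> v \<preceq> u" for u v
  proof -
    obtain u' where u': "u * u' = 1" using inverse_exists \<open>u \<noteq> 0\<close> by blast
    then have v: "v = u * (u' * v)" by (metis mult.assoc mult_1)
    then have "u' * v \<noteq> 0" using \<open>v \<noteq> 0\<close> by auto
    moreover have "\<not> u' * v \<preceq> 1"
      using that(3) v mult_mono[of "u' * v" 1 u] by auto
    ultimately show ?thesis
      using logarithm_mult[OF \<open>u \<noteq> 0\<close>, of "u' * v"] logarithm_pos[of "u' * v"] v by simp
  qed
  have mono: "logarithm b x \<le> logarithm b y" if "x \<preceq> y"
  proof (rule field_le_epsilon)
    fix e :: real assume "e > 0"
    then have "logarithm b x - e < logarithm b x" by simp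
    from exponent_below[OF x this] obtain i j n where *: "n > 0" "logarithm b x - e < (real i - real j) / real n"
        "b ^ i \<preceq> b ^ j * x ^ n"
      by metis
    have "b ^ i \<preceq> b ^ j * y ^ n" using *(3) mult_mono[OF power_mono[OF that]] le_trans by blast
    then show "logarithm b x \<le> logarithm b y + e" using logarithm_ge[OF y *(1)] * by fastforce
  qed
  show ?thesis using strict[OF y x] mono by force
qed

end

end

text \<open>An embedding of the multiplicative and order structure only. Whether it carries addition to
  the maximum or to the sum depends on \<open>1 + 1\<close>, and in the latter case on the scaling of \<open>g\<close>.\<close>

locale real_embedding = archimedean_semifield +
  fixes g :: "'a \<Rightarrow> real"
  assumes g_0: "g 0 = 0"
    and g_1: "g 1 = 1"
    and g_mult: "g (x * y) = g x * g y"
    and g_le_iff: "g x \<le> g y \<longleftrightarrow> x \<preceq> y"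

text \<open>Taking the powers to base \<open>2\<close> normalises \<open>g b = 2\<close>, which is what makes the base
  \<open>b = 1 + 1\<close> compatible with the natural numbers.\<close>

lemma (in archimedean_semifield) hoelder:
  assumes b: "\<not> b \<preceq> 1"
  obtains g where "real_embedding (\<preceq>) g" "g b = 2"
proof -
  define g where "g x = (if x = 0 then 0 else 2 powr logarithm b x)" for x
  have "real_embedding (\<preceq>) g"
  proof unfold_locales
    fix x y
    show "g 0 = 0" by (simp add: g_def)
    show "g 1 = 1" by (simp add: g_def logarithm_one[OF b])
    show "g (x * y) = g x * g y"
      by (simp add: g_def mult_eq_0 logarithm_mult[OF b] powr_add)
    show "g x \<le> g y \<longleftrightarrow> x \<preceq> y"
      using not_le_zero[of x] zero_le[of y]
      by (simp add: g_def logarithm_le_iff[OF b] powr_le_cancel_iff)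
  qed
  moreover have "g b = 2" using base_nonzero[OF b] by (simp add: g_def logarithm_base[OF b])
  ultimately show ?thesis using that by blast
qed

context real_embedding
begin

lemma g_nonneg: "g x \<ge> 0"
  using g_le_iff[of 0 x] zero_le g_0 by simp

lemma g_pos: "x \<noteq> 0 \<Longrightarrow> g x > 0"
  using g_le_iff[of x 0] not_le_zero g_0 by force

lemma g_power: "g (x ^ n) = g x ^ n"
  by (induction n) (simp_all add: g_1 g_mult)

lemma g_inverse:
  assumes "x \<noteq> 0"
  obtains y where "y \<noteq> 0" "g y = 1 / g x"
proof -
  obtain y where y: "x * y = 1" using inverse_exists assms by blast
  then have "y \<noteq> 0" by auto
  moreover have "g x * g y = 1" using y g_mult g_1 by metis
  ultimately show ?thesis using that g_pos[OF assms] by (simp add: field_simps)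
qed



section \<open>Dedekind completeness and density\<close>

text \<open>Multiplying repeatedly by a \<open>w\<close> whose value is just above \<open>1\<close>, starting from a value to the
  left of the interval, gives steps too small to jump over the interval.\<close>

lemma dense_of_small_ratios:
  assumes small: "\<And>e. e > 1 \<Longrightarrow> \<exists>w. 1 < g w \<and> g w < e"
    and r: "0 \<le> r" "r < s"
  shows "\<exists>x. r < g x \<and> g x < s"
proof -
  \<comment> \<open>The left end point is moved away from \<open>0\<close>, so that \<open>s / t\<close> makes sense.\<close>
  define t where "t = max r (s / 2)"
  have t: "0 < t" "t < s" "r \<le> t" using r by (auto simp: t_def)
  obtain w where w: "1 < g w" "g w < s / t" using small[of "s / t"] t by auto
  have w0: "w \<noteq> 0" using w g_0 by auto
  obtain N where N: "1 / t < g w ^ N" using real_arch_pow[OF w(1)] by blast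
  obtain v where v: "g v = 1 / g (w ^ N)"
    using g_inverse[OF power_nonzero[OF w0]] by blast
  have v_le: "g v \<le> t"
  proof -
    have "g w ^ N > 0" using w by simp
    then show ?thesis using N t(1) v by (simp add: g_power field_simps)
  qed
  have vpos: "g v > 0" using w by (simp add: v g_power)
  obtain M where M: "t / g v < g w ^ M" using real_arch_pow[OF w(1)] by blast
  define k where "k = (LEAST k. t < g (v * w ^ k))"
  have ex: "t < g (v * w ^ M)" using M vpos by (simp add: g_mult g_power field_simps)
  have k: "t < g (v * w ^ k)" unfolding k_def using ex by (rule LeastI)
  have "k \<noteq> 0"
  proof
    assume "k = 0"
    then show False using k v_le by simp
  qed
  then obtain l where l: "k = Suc l" by (cases k) auto
  have "g (v * w ^ l) \<le> t" using not_less_Least[of l "\<lambda>k. t < g (v * w ^ k)"] l k_def by fastforce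
  then have "g (v * w ^ k) \<le> t * g w"
    using w(1) by (simp add: l g_mult g_power mult.left_commute mult.commute[of _ "g w"] mult_left_mono)
  also have "\<dots> < s" using w(2) t by (simp add: field_simps)
  finally show ?thesis using k t(3) by (meson le_less_trans)
qed

text \<open>By density, the elements of value below \<open>r\<close> have no greatest one, so they form a cut; an
  element that represents it can only have value \<open>r\<close>.\<close>

lemma surj_of_dense:
  assumes complete: "dedekind_complete (\<preceq>)"
    and dense: "\<And>r s. 0 \<le> r \<Longrightarrow> r < s \<Longrightarrow> \<exists>x. r < g x \<and> g x < s"
    and "r \<ge> 0"
  shows "\<exists>x. g x = r"
proof (cases "r = 0")
  case True
  then show ?thesis using g_0 by blast
next
  case False
  have strict: "strict_of (\<preceq>) x y \<longleftrightarrow> g x < g y" for x y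
    unfolding strict_of_def g_le_iff[symmetric] by auto
  have "dedekind_cut (\<preceq>) {x. g x < r}"
    unfolding dedekind_cut_def
  proof (intro conjI ballI allI impI)
    fix x y assume "x \<in> {x. g x < r}" "y \<preceq> x"
    then show "y \<in> {x. g x < r}" by (simp flip: g_le_iff)
  next
    fix x assume "x \<in> {x. g x < r}"
    then have "g x < r" by simp
    then show "\<exists>y\<in>{x. g x < r}. strict_of (\<preceq>) x y"
      using dense[OF g_nonneg[of x] \<open>g x < r\<close>] strict by auto
  next
    obtain x where "r < g x" using dense[of r "r + 1"] \<open>r \<ge> 0\<close> by auto
    then show "{x. g x < r} \<noteq> UNIV" by (metis (mono_tags) UNIV_I mem_Collect_eq less_asym)
  qed
  then obtain z where "{x. g x < r} = {y. strict_of (\<preceq>) y z}"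
    using complete unfolding dedekind_complete_def by blast
  then have z: "g x < r \<longleftrightarrow> g x < g z" for x using strict by auto
  have "g z = r"
  proof (rule ccontr)
    assume "g z \<noteq> r"
    then consider "g z < r" | "r < g z" by linarith
    then show False
    proof cases
      case 1 then show ?thesis using z[of z] by simp
    next
      case 2
      then obtain x where "r < g x" "g x < g z" using dense[OF \<open>r \<ge> 0\<close>] by blast
      then show ?thesis using z[of x] by simp
    qed
  qed
  then show ?thesis by blast
qed

text \<open>If ratios below \<open>e\<close> were missing, then an element close to the infimum of the values above
  \<open>1\<close> and a smaller one would have quotient below \<open>e\<close>.\<close>

lemma small_ratios_of_no_atom:
  assumes ex: "1 < g b"
    and no_atom: "\<And>x. 1 < g x \<Longrightarrow> \<exists>y. 1 < g y \<and> g y < g x"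
    and e: "e > 1"
  shows "\<exists>w. 1 < g w \<and> g w < e"
proof (rule ccontr)
  assume none: "\<not> ?thesis"
  define A where "A = {g x | x. 1 < g x}"
  define c where "c = Inf A"
  have ne: "A \<noteq> {}" using ex by (auto simp: A_def)
  have bdd: "bdd_below A" by (rule bdd_belowI[of _ 1]) (auto simp: A_def)
  have "c \<ge> e" unfolding c_def by (rule cInf_greatest[OF ne]) (use none in \<open>force simp: A_def\<close>)
  then have "c < c * e" using e by simp
  then obtain w where w: "1 < g w" "g w < c * e"
    using cInf_lessD[OF ne, of "c * e"] by (auto simp: c_def A_def)
  obtain u where u: "1 < g u" "g u < g w" using no_atom w by blast
  have "c \<le> g u" unfolding c_def by (rule cInf_lower[OF _ bdd]) (use u in \<open>auto simp: A_def\<close>)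
  have "u \<noteq> 0" using u g_0 by auto
  then obtain u' where "g u' = 1 / g u" using g_inverse by blast
  then have quot: "g (w * u') = g w / g u" by (simp add: g_mult)
  have "g w < g u * e" using w(2) \<open>c \<le> g u\<close> e by (meson less_le_trans mult_right_mono less_imp_le less_trans zero_less_one)
  then have "1 < g (w * u')" "g (w * u') < e" unfolding quot using u by (simp_all add: field_simps)
  then show False using none by blast
qed


section \<open>The idempotent case\<close>

text \<open>For \<open>x \<preceq> y\<close> the sum is caught between \<open>y\<close> and \<open>y * (1 + 1)\<close>, which are equivalent.\<close>

lemma g_add_idempotent:
  assumes "1 + 1 \<preceq> 1"
  shows "g (x + y) = max (g x) (g y)"
proof -
  have *: "g (x + y) = g y" if "x \<preceq> y" for x y
  proof (rule antisym)
    have "x + y \<preceq> y * (1 + 1)"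
      using add_mono[OF that, of y] by (simp only: distrib_left mult_1_right add.commute)
    also have "\<dots> \<preceq> y" using mult_mono[OF assms, of y] by simp
    finally show "g (x + y) \<le> g y" by (simp add: g_le_iff)
    show "g y \<le> g (x + y)" using le_add[of y x] by (simp add: g_le_iff add.commute)
  qed
  show ?thesis
    using total[of x y] *[of x y] *[of y x] g_le_iff[of x y] g_le_iff[of y x]
    by (auto simp: add.commute max_def)
qed

lemma equivalent_trop_real:
  assumes "1 + 1 \<preceq> 1" and surj: "\<And>r. r \<ge> 0 \<Longrightarrow> \<exists>x. g x = r"
  shows "equivalent_to (\<preceq>) ((\<le>) :: trop_real \<Rightarrow> _)"
proof -
  define f where "f x = Abs_trop_real (g x)" for x
  have f: "real_of_trop_real (f x) = g x" for x
    by (simp add: f_def Abs_trop_real_inverse g_nonneg)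
  have le: "x \<preceq> y \<longleftrightarrow> f x \<le> f y" for x y
    by (simp add: less_eq_trop_real.rep_eq f g_le_iff)
  have "semiring_hom f"
    unfolding semiring_hom_def
    by (auto simp: real_of_trop_real_inject[symmetric] f g_0 g_1 g_mult
        g_add_idempotent[OF assms(1)] zero_trop_real.rep_eq one_trop_real.rep_eq
        plus_trop_real.rep_eq times_trop_real.rep_eq)
  moreover have "\<exists>x. f x = y" for y
    using surj[of "real_of_trop_real y"] real_of_trop_real[of y]
    by (auto simp: f real_of_trop_real_inject[symmetric])
  ultimately show ?thesis using le by (intro equivalent_toI)
qed

lemma powers_of_two_attained:
  assumes b: "g b = 2"
  shows "\<exists>x. g x = 2 powr (m::int)"
proof (cases "m \<ge> 0")
  case True
  then have "g (b ^ nat m) = 2 powr m" by (simp add: g_power b flip: powr_realpow)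
  then show ?thesis by blast
next
  case False
  have "b \<noteq> 0" using b g_0 by auto
  then obtain y where "g y = 1 / g (b ^ nat (- m))" using g_inverse power_nonzero by metis
  also have "\<dots> = 2 powr m" using False by (simp add: g_power b powr_minus field_simps flip: powr_realpow)
  finally show ?thesis by blast
qed

text \<open>If the base of the embedding is the least element above \<open>1\<close>, then dividing by a suitable
  power of it brings every value into \<open>[1, 2)\<close>, where only \<open>1\<close> is attained.\<close>

lemma value_power_of_atom:
  assumes b: "g b = 2" and atom: "\<And>x. \<not> (1 < g x \<and> g x < 2)" and x: "x \<noteq> 0"
  obtains m :: int where "g x = 2 powr m"
proof -
  define m where "m = \<lfloor>log 2 (g x)\<rfloor>"
  have gx: "g x > 0" using g_pos x .
  define P :: real where "P = 2 powr m"
  have P: "P > 0" by (simp add: P_def)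
  obtain y where "g y = 2 powr (- m)" using powers_of_two_attained[OF b, of "- m"] by auto
  then have y: "g y = 1 / P" by (simp add: P_def powr_minus_divide)
  have "m \<le> log 2 (g x)" "log 2 (g x) < m + 1" unfolding m_def by linarith+
  then have "2 powr m \<le> 2 powr log 2 (g x)" "2 powr log 2 (g x) < 2 powr (m + 1)"
    by (simp_all only: powr_le_cancel_iff powr_less_cancel_iff one_less_numeral_iff semiring_norm)
  then have "P \<le> g x" "g x < 2 * P"
    using gx by (simp_all add: powr_add P_def)
  then have "1 \<le> g (x * y)" "g (x * y) < 2" using P by (simp_all add: g_mult y pos_divide_less_eq)
  then have "g (x * y) = 1" using atom[of "x * y"] by linarith
  then have "g x = P" using P by (simp add: g_mult y)
  then show ?thesis unfolding P_def by (rule that)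
qed

lemma equivalent_trop_int:
  assumes idem: "1 + 1 \<preceq> 1" and b: "g b = 2" and atom: "\<And>x. \<not> (1 < g x \<and> g x < 2)"
  shows "equivalent_to (\<preceq>) ((\<le>) :: trop_int \<Rightarrow> _)"
proof -
  \<comment> \<open>Comparing values in the reals avoids case distinctions on \<open>MInf\<close> for the map itself.\<close>
  define val :: "trop_int \<Rightarrow> real" where
    "val t = (case t of MInf \<Rightarrow> 0 | Trop m \<Rightarrow> 2 powr m)" for t
  have val_simps: "val MInf = 0" "val (Trop m) = 2 powr m" for m by (simp_all add: val_def)
  have val_le: "val s \<le> val t \<longleftrightarrow> s \<le> t" for s t
    by (cases s; cases t) (auto simp: val_simps not_le)
  have val_eq: "val s = val t \<longleftrightarrow> s = t" for s t
    using val_le[of s t] val_le[of t s] by (auto simp: order_eq_iff)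
  have val_mult: "val (s * t) = val s * val t" for s t
    by (cases s; cases t) (auto simp: val_simps powr_add)
  have val_add: "val (s + t) = max (val s) (val t)" for s t
    by (simp add: plus_trop_int_def max_def val_le)
  have "\<exists>t. val t = g x" for x
  proof (cases "x = 0")
    case True then show ?thesis using g_0 val_simps(1) by metis
  next
    case False
    then obtain m :: int where "g x = 2 powr m" by (rule value_power_of_atom[OF b atom])
    then have "val (Trop m) = g x" by (simp add: val_simps)
    then show ?thesis by blast
  qed
  then obtain f where f: "val (f x) = g x" for x by metis
  have le: "x \<preceq> y \<longleftrightarrow> f x \<le> f y" for x y by (simp flip: g_le_iff val_le add: f)
  have "semiring_hom f"
    unfolding semiring_hom_def
    by (auto simp: val_eq[symmetric] f g_0 g_1 g_mult val_mult val_add val_simps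
        g_add_idempotent[OF idem] zero_trop_int_def one_trop_int_def)
  moreover have "\<exists>x. f x = t" for t
  proof (cases t)
    case MInf then show ?thesis using f[of 0] g_0 val_simps(1) val_eq by metis
  next
    case (Trop m)
    obtain x where "g x = 2 powr m" using powers_of_two_attained[OF b] by blast
    then have "val (f x) = val t" by (simp add: f Trop val_simps)
    then show ?thesis using val_eq by blast
  qed
  ultimately show ?thesis using le by (intro equivalent_toI)
qed


section \<open>The non-idempotent case\<close>

lemma equivalent_nnreal:
  assumes add: "\<And>x y. g (x + y) = g x + g y" and surj: "\<And>r. r \<ge> 0 \<Longrightarrow> \<exists>x. g x = r"
  shows "equivalent_to (\<preceq>) ((\<le>) :: nnreal \<Rightarrow> _)"
proof -
  define f where "f x = Abs_nnreal (g x)" for x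
  have f: "real_of_nnreal (f x) = g x" for x
    by (simp add: f_def Abs_nnreal_inverse g_nonneg)
  have le: "x \<preceq> y \<longleftrightarrow> f x \<le> f y" for x y
    by (simp add: less_eq_nnreal.rep_eq f g_le_iff)
  have "semiring_hom f"
    unfolding semiring_hom_def
    by (auto simp: real_of_nnreal_inject[symmetric] f g_0 g_1 g_mult add
        zero_nnreal.rep_eq one_nnreal.rep_eq plus_nnreal.rep_eq times_nnreal.rep_eq)
  moreover have "\<exists>x. f x = y" for y
    using surj[of "real_of_nnreal y"] real_of_nnreal[of y]
    by (auto simp: f real_of_nnreal_inject[symmetric])
  ultimately show ?thesis using le by (intro equivalent_toI)
qed

context
  assumes two: "\<not> 1 + 1 \<preceq> 1" and g_two: "g (1 + 1) = 2"
begin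

text \<open>Powers of two bracket \<open>n ^ k\<close> in the natural numbers, hence also in the semifield, and
  \<open>g\<close> is multiplicative; so \<open>k * log 2 (g n)\<close> and \<open>k * log 2 n\<close> differ by at most \<open>1\<close> for
  every \<open>k\<close>.\<close>

lemma g_of_nat: "g (of_nat n) = real n"
proof (cases "n = 0")
  case True then show ?thesis by (simp add: g_0)
next
  case False
  have two_pow: "g (of_nat (2 ^ m)) = 2 ^ m" for m
  proof -
    have "of_nat (2 ^ m) = ((1 + 1) ^ m :: 'a)" by simp
    then show ?thesis by (simp only: g_power g_two)
  qed
  have "1 \<preceq> of_nat n" using of_nat_le_iff_non_idempotent[OF two, of 1 n] False by simp
  then have "1 \<le> g (of_nat n)" unfolding g_le_iff[symmetric] g_1 .
  then have gn: "g (of_nat n) > 0" by simp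
  have bracket: "\<exists>m. 2 ^ m \<le> n ^ k \<and> n ^ k \<le> 2 ^ (m + 1)" for k
    using ex_power_ivl1[of 2 "n ^ k"] False by (simp add: Suc_le_eq) (meson less_imp_le)
  have "log 2 (g (of_nat n)) = log 2 (real n)"
  proof (rule eq_of_bounded_multiples[where K = 1])
    fix k :: nat
    obtain m where m: "2 ^ m \<le> n ^ k" "n ^ k \<le> 2 ^ (m + 1)" using bracket by blast
    have "of_nat (2 ^ m) \<preceq> of_nat (n ^ k)" "of_nat (n ^ k) \<preceq> of_nat (2 ^ (m + 1))"
      using m of_nat_le_iff_non_idempotent[OF two] by blast+
    then have "g (of_nat (2 ^ m)) \<le> g (of_nat (n ^ k))" "g (of_nat (n ^ k)) \<le> g (of_nat (2 ^ (m + 1)))"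
      by (simp_all add: g_le_iff)
    then have g: "2 ^ m \<le> g (of_nat n) ^ k" "g (of_nat n) ^ k \<le> 2 ^ (m + 1)"
      unfolding two_pow of_nat_power[of n k] g_power by auto
    have r: "2 ^ m \<le> real n ^ k" "real n ^ k \<le> 2 ^ (m + 1)"
      using m by (metis of_nat_le_iff of_nat_power of_nat_numeral)+
    have log_bounds: "m \<le> k * log 2 z" "k * log 2 z \<le> m + 1"
      if "z > 0" "2 ^ m \<le> z ^ k" "z ^ k \<le> 2 ^ (m + 1)" for z :: real
    proof -
      have "log 2 (2 ^ m) \<le> log 2 (z ^ k)" "log 2 (z ^ k) \<le> log 2 (2 ^ (m + 1))"
        using that by (subst log_le_cancel_iff; simp)+
      then show "m \<le> k * log 2 z" "k * log 2 z \<le> m + 1"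
        using that(1) by (simp_all add: log_nat_power del: power_Suc)
    qed
    show "real k * log 2 (g (of_nat n)) \<le> real k * log 2 (real n) + 1"
      "real k * log 2 (real n) \<le> real k * log 2 (g (of_nat n)) + 1"
      using log_bounds[OF gn g] log_bounds[OF _ r] False by simp_all
  qed
  then have "2 powr log 2 (g (of_nat n)) = 2 powr log 2 (real n)" by (rule arg_cong)
  then show ?thesis using gn False by simp
qed

text \<open>Approximating \<open>n * g x\<close> and \<open>n * g y\<close> by integers costs at most \<open>2\<close>, whatever \<open>n\<close> is.\<close>

lemma g_add: "g (x + y) = g x + g y"
proof (rule eq_of_bounded_multiples[where K = 2])
  fix n :: nat
  have gn: "g (of_nat n * z) = n * g z" for z by (simp add: g_mult g_of_nat)
  have nonneg: "0 \<le> n * g z" for z using g_nonneg by simp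
  show "n * g (x + y) \<le> n * (g x + g y) + 2"
  proof -
    define p where "p z = nat \<lceil>n * g z\<rceil>" for z
    have p: "n * g z \<le> real (p z)" "real (p z) \<le> n * g z + 1" for z
      using nonneg[of z] unfolding p_def by linarith+
    have up: "of_nat n * z \<preceq> of_nat (p z)" for z
      using p(1)[of z] by (simp flip: g_le_iff add: gn g_of_nat)
    have "of_nat n * (x + y) \<preceq> of_nat (p x + p y)"
      using add_mono_both[OF up[of x] up[of y]] by (simp add: distrib_left)
    then have "n * g (x + y) \<le> real (p x + p y)" unfolding g_le_iff[symmetric] gn g_of_nat .
    then show ?thesis using p[of x] p[of y] by (simp add: distrib_left)
  qed
  show "n * (g x + g y) \<le> n * g (x + y) + 2"
  proof -
    define p where "p z = nat \<lfloor>n * g z\<rfloor>" for z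
    have p: "real (p z) \<le> n * g z" "n * g z \<le> real (p z) + 1" for z
      using nonneg[of z] unfolding p_def by linarith+
    have lo: "of_nat (p z) \<preceq> of_nat n * z" for z
      using p(1)[of z] by (simp flip: g_le_iff add: gn g_of_nat)
    have "of_nat (p x + p y) \<preceq> of_nat n * (x + y)"
      using add_mono_both[OF lo[of x] lo[of y]] by (simp add: distrib_left)
    then have "real (p x + p y) \<le> n * g (x + y)" unfolding g_le_iff[symmetric] gn g_of_nat .
    then show ?thesis using p[of x] p[of y] by (simp add: distrib_left)
  qed
qed

text \<open>Quotients \<open>(n + 1) / n\<close> of natural numbers serve, since \<open>g\<close> fixes them.\<close>

lemma small_ratios_non_idempotent:
  assumes "e > 1"
  shows "\<exists>w. 1 < g w \<and> g w < e"
proof -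
  obtain n :: nat where n: "1 < real n * (e - 1)"
    using reals_Archimedean3[of "e - 1"] assms by auto
  then have "n > 0" by (cases n) auto
  with n have n: "n > 0" "1 < real n * (e - 1)" by auto
  have "of_nat n \<noteq> (0::'a)" using g_of_nat[of n] g_0 n by auto
  from g_inverse[OF this] obtain y where "g y = 1 / real n" unfolding g_of_nat by blast
  then have quot: "g (of_nat (n + 1) * y) = (real n + 1) / real n" unfolding g_mult g_of_nat by simp
  have "1 < (real n + 1) / real n" "(real n + 1) / real n < e"
    using n by (simp_all add: field_simps)
  then show ?thesis unfolding quot[symmetric] by blast
qed

end

end


section \<open>Existence\<close>

context archimedean_semifield
begin

lemma equivalent_boolsf:
  assumes triv: "\<And>x. x \<preceq> 1"
  shows "equivalent_to (\<preceq>) ((\<le>) :: boolsf \<Rightarrow> _)"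
proof -
  define f where "f x = (if x = (0::'a) then BZero else BOne)" for x
  have one_le: "1 \<preceq> x" if x: "x \<noteq> 0" for x
  proof -
    obtain y where "x * y = 1" using inverse_exists x by blast
    then show ?thesis using mult_mono[OF triv[of y], of x] by simp
  qed
  have le: "x \<preceq> y \<longleftrightarrow> f x \<le> f y" for x y
    using triv[of x] one_le[of y] le_trans not_le_zero[of x] zero_le[of y]
    by (auto simp: f_def less_eq_boolsf_def)
  have sum0: "x + y = 0 \<longleftrightarrow> x = 0 \<and> y = 0" for x y :: 'a
  proof
    assume "x + y = 0"
    then have "x \<preceq> 0" "y \<preceq> 0" using le_add[of x y] le_add[of y x] by (simp_all add: add.commute)
    then show "x = 0 \<and> y = 0" using not_le_zero by blast
  qed simp
  have "semiring_hom f"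
    unfolding semiring_hom_def
    by (auto simp: f_def sum0 mult_eq_0 zero_boolsf_def one_boolsf_def
        plus_boolsf_def times_boolsf_def)
  moreover have "\<exists>x. f x = y" for y
  proof (cases y)
    case BZero then show ?thesis by (intro exI[of _ 0]) (simp add: f_def)
  next
    case BOne then show ?thesis by (intro exI[of _ 1]) (simp add: f_def)
  qed
  ultimately show ?thesis using le by (intro equivalent_toI)
qed

lemma classification:
  assumes complete: "dedekind_complete (\<preceq>)"
  shows "equivalent_to (\<preceq>) ((\<le>) :: nnreal \<Rightarrow> _) \<or> equivalent_to (\<preceq>) ((\<le>) :: boolsf \<Rightarrow> _) \<or>
         equivalent_to (\<preceq>) ((\<le>) :: trop_int \<Rightarrow> _) \<or> equivalent_to (\<preceq>) ((\<le>) :: trop_real \<Rightarrow> _)"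
proof (cases "1 + 1 \<preceq> 1")
  case two: False
  then obtain g where "real_embedding (\<preceq>) g" and g2: "g (1 + 1) = 2" by (rule hoelder)
  then interpret real_embedding "(\<preceq>)" g by simp
  have "\<exists>x. g x = r" if "r \<ge> 0" for r
    using surj_of_dense[OF complete dense_of_small_ratios[OF small_ratios_non_idempotent[OF two g2]] that] .
  then show ?thesis using equivalent_nnreal[OF g_add[OF two g2]] by blast
next
  case idem: True
  consider (triv) "\<And>x. x \<preceq> 1"
    | (atom) b where "\<not> b \<preceq> 1" "\<And>x. \<not> x \<preceq> 1 \<Longrightarrow> b \<preceq> x"
    | (dense) b where "\<not> b \<preceq> 1" "\<And>x. \<not> x \<preceq> 1 \<Longrightarrow> \<exists>y. \<not> y \<preceq> 1 \<and> \<not> x \<preceq> y"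
    by metis
  then show ?thesis
  proof cases
    case triv
    then show ?thesis using equivalent_boolsf by blast
  next
    case atom
    obtain g where "real_embedding (\<preceq>) g" and gb: "g b = 2" using hoelder[OF atom(1)] .
    then interpret real_embedding "(\<preceq>)" g by simp
    have "\<not> (1 < g x \<and> g x < 2)" for x
      using atom(2)[of x] g_le_iff[of x 1] g_le_iff[of b x] gb g_1 by auto
    then show ?thesis using equivalent_trop_int[OF idem gb] by blast
  next
    case dense
    obtain g where "real_embedding (\<preceq>) g" and gb: "g b = 2" using hoelder[OF dense(1)] .
    then interpret real_embedding "(\<preceq>)" g by simp
    have "\<exists>y. 1 < g y \<and> g y < g x" if "1 < g x" for x
    proof -
      have "\<not> x \<preceq> 1" using that g_1 by (simp flip: g_le_iff)
      then obtain y where y: "\<not> y \<preceq> 1" "\<not> x \<preceq> y" using dense(2) by blast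
      have "1 < g y" "g y < g x" using y unfolding g_le_iff[symmetric] g_1 by simp_all
      then show ?thesis by blast
    qed
    moreover have "1 < g b" using gb by simp
    ultimately have "\<exists>w. 1 < g w \<and> g w < e" if "e > 1" for e
      using small_ratios_of_no_atom that by blast
    then have "\<exists>x. g x = r" if "r \<ge> 0" for r
      using surj_of_dense[OF complete dense_of_small_ratios that] by blast
    then show ?thesis using equivalent_trop_real[OF idem] by blast
  qed
qed

end


section \<open>Uniqueness\<close>

definition has_above_one :: "('a::comm_semiring_1 \<Rightarrow> 'a \<Rightarrow> bool) \<Rightarrow> bool" where
  "has_above_one le \<longleftrightarrow> (\<exists>x. \<not> le x 1)"

definition has_atom :: "('a::comm_semiring_1 \<Rightarrow> 'a \<Rightarrow> bool) \<Rightarrow> bool" where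
  "has_atom le \<longleftrightarrow> (\<exists>x. \<not> le x 1 \<and> (\<forall>y. \<not> le y 1 \<longrightarrow> le x y))"

text \<open>An equivalence to an antisymmetric model is surjective, so it transports every property
  that is phrased through \<open>1\<close>, \<open>+\<close> and the preorder.\<close>

lemma equivalent_to_invariants:
  fixes leF :: "'a::comm_semiring_1 \<Rightarrow> 'a \<Rightarrow> bool"
  assumes "equivalent_to leF ((\<le>) :: 'b::{comm_semiring_1, linorder} \<Rightarrow> 'b \<Rightarrow> bool)"
  shows "leF (1 + 1) 1 \<longleftrightarrow> (1::'b) + 1 \<le> 1"
    and "has_above_one leF \<longleftrightarrow> has_above_one ((\<le>) :: 'b \<Rightarrow> _)"
    and "has_atom leF \<longleftrightarrow> has_atom ((\<le>) :: 'b \<Rightarrow> _)"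
proof -
  obtain f :: "'a \<Rightarrow> 'b" where f: "f 1 = 1" "\<And>x y. f (x + y) = f x + f y"
      "\<And>x y. leF x y \<longleftrightarrow> f x \<le> f y" and "\<And>y. \<exists>x. equiv_of (\<le>) (f x) y"
    using assms unfolding equivalent_to_def semiring_hom_def by blast
  then have surj: "\<exists>x. y = f x" for y by (metis equiv_of_def order_antisym)
  have ex: "(\<exists>y. P y) \<longleftrightarrow> (\<exists>x. P (f x))" and all: "(\<forall>y. P y) \<longleftrightarrow> (\<forall>x. P (f x))" for P
    using surj by metis+
  show "leF (1 + 1) 1 \<longleftrightarrow> (1::'b) + 1 \<le> 1" unfolding f(3) f(2) f(1) ..
  show "has_above_one leF \<longleftrightarrow> has_above_one ((\<le>) :: 'b \<Rightarrow> _)"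
    unfolding has_above_one_def ex f(3) f(1) ..
  show "has_atom leF \<longleftrightarrow> has_atom ((\<le>) :: 'b \<Rightarrow> _)"
    unfolding has_atom_def ex all f(3) f(1) ..
qed

lemma nnreal_not_idempotent: "\<not> (1::nnreal) + 1 \<le> 1"
  by transfer simp

lemma boolsf_idempotent: "(1::boolsf) + 1 \<le> 1"
  by (simp add: less_eq_boolsf_def plus_boolsf_def one_boolsf_def)

lemma trop_int_idempotent: "(1::trop_int) + 1 \<le> 1"
  by (simp add: plus_trop_int_def)

lemma trop_real_idempotent: "(1::trop_real) + 1 \<le> 1"
  by transfer simp

lemma boolsf_no_above_one: "\<not> has_above_one ((\<le>) :: boolsf \<Rightarrow> _)"
  by (simp add: has_above_one_def less_eq_boolsf_def one_boolsf_def)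

lemma trop_int_atom: "has_atom ((\<le>) :: trop_int \<Rightarrow> _)"
proof -
  have "Trop 1 \<le> y" if "\<not> y \<le> 1" for y
    using that by (cases y) (auto simp: one_trop_int_def)
  then show ?thesis unfolding has_atom_def by (intro exI[of _ "Trop 1"]) (auto simp: one_trop_int_def)
qed

lemma trop_real_above_one: "has_above_one ((\<le>) :: trop_real \<Rightarrow> _)"
  unfolding has_above_one_def by transfer (rule bexI[of _ 2], auto)

lemma trop_real_no_atom: "\<not> has_atom ((\<le>) :: trop_real \<Rightarrow> _)"
  unfolding has_atom_def
proof (transfer, clarsimp simp: not_le)
  fix x :: real assume "1 < x"
  then show "\<exists>y\<ge>0. 1 < y \<and> y < x" using dense[of 1 x] by (metis less_imp_le less_trans zero_less_one)
qed

lemma has_atom_imp_above_one: "has_atom le \<Longrightarrow> has_above_one le"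
  unfolding has_atom_def has_above_one_def by blast

lemma exactly_one_four:
  assumes "A \<or> B \<or> C \<or> D"
    and "\<not> (A \<and> B)" "\<not> (A \<and> C)" "\<not> (A \<and> D)" "\<not> (B \<and> C)" "\<not> (B \<and> D)" "\<not> (C \<and> D)"
  shows "exactly_one [A, B, C, D]"
proof -
  have "(i < length [A, B, C, D] \<and> [A, B, C, D] ! i) \<longleftrightarrow>
      i = 0 \<and> A \<or> i = 1 \<and> B \<or> i = 2 \<and> C \<or> i = 3 \<and> D" for i
    by (auto simp: less_Suc_eq numeral_eq_Suc)
  then show ?thesis unfolding exactly_one_def using assms by auto
qed

lemma (in archimedean_semifield) exactly_one_model:
  assumes "dedekind_complete (\<preceq>)"
  shows "exactly_one
      [equivalent_to (\<preceq>) ((\<le>) :: nnreal \<Rightarrow> nnreal \<Rightarrow> bool),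
       equivalent_to (\<preceq>) ((\<le>) :: boolsf \<Rightarrow> boolsf \<Rightarrow> bool),
       equivalent_to (\<preceq>) ((\<le>) :: trop_int \<Rightarrow> trop_int \<Rightarrow> bool),
       equivalent_to (\<preceq>) ((\<le>) :: trop_real \<Rightarrow> trop_real \<Rightarrow> bool)]"
proof (rule exactly_one_four[OF classification[OF assms]])
  note real = equivalent_to_invariants[where leF = "(\<preceq>)" and 'b = nnreal]
    and bool = equivalent_to_invariants[where leF = "(\<preceq>)" and 'b = boolsf]
    and tint = equivalent_to_invariants[where leF = "(\<preceq>)" and 'b = trop_int]
    and treal = equivalent_to_invariants[where leF = "(\<preceq>)" and 'b = trop_real]
  show "\<not> (equivalent_to (\<preceq>) ((\<le>) :: nnreal \<Rightarrow> _) \<and> equivalent_to (\<preceq>) ((\<le>) :: boolsf \<Rightarrow> _))"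
    using real(1) bool(1) nnreal_not_idempotent boolsf_idempotent by blast
  show "\<not> (equivalent_to (\<preceq>) ((\<le>) :: nnreal \<Rightarrow> _) \<and> equivalent_to (\<preceq>) ((\<le>) :: trop_int \<Rightarrow> _))"
    using real(1) tint(1) nnreal_not_idempotent trop_int_idempotent by blast
  show "\<not> (equivalent_to (\<preceq>) ((\<le>) :: nnreal \<Rightarrow> _) \<and> equivalent_to (\<preceq>) ((\<le>) :: trop_real \<Rightarrow> _))"
    using real(1) treal(1) nnreal_not_idempotent trop_real_idempotent by blast
  show "\<not> (equivalent_to (\<preceq>) ((\<le>) :: boolsf \<Rightarrow> _) \<and> equivalent_to (\<preceq>) ((\<le>) :: trop_int \<Rightarrow> _))"
    using bool(2) tint(2) boolsf_no_above_one has_atom_imp_above_one[OF trop_int_atom] by blast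
  show "\<not> (equivalent_to (\<preceq>) ((\<le>) :: boolsf \<Rightarrow> _) \<and> equivalent_to (\<preceq>) ((\<le>) :: trop_real \<Rightarrow> _))"
    using bool(2) treal(2) boolsf_no_above_one trop_real_above_one by blast
  show "\<not> (equivalent_to (\<preceq>) ((\<le>) :: trop_int \<Rightarrow> _) \<and> equivalent_to (\<preceq>) ((\<le>) :: trop_real \<Rightarrow> _))"
    using tint(3) treal(3) trop_int_atom trop_real_no_atom by blast
qed


section \<open>Duality\<close>

lemma totally_preordered_semifield_conversep:
  assumes "totally_preordered_semifield le"
  shows "totally_preordered_semifield le\<inverse>\<inverse>"
proof -
  interpret totally_preordered_semifield le by fact
  show ?thesis
  proof unfold_locales
    show "reflp le\<inverse>\<inverse>" using reflp_le by simp
    show "transp le\<inverse>\<inverse>" using transp_le by simp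
  qed (use inverse_exists not_field one_zero_not_equiv total in
      \<open>auto intro: add_mono mult_mono\<close>)
qed

text \<open>Inversion reverses the order of the nonzero elements, so the Archimedean property is
  symmetric in the two directions.\<close>

lemma mult_archimedean_conversep:
  assumes "totally_preordered_semifield le" and arch: "mult_archimedean le"
  shows "mult_archimedean le\<inverse>\<inverse>"
  unfolding mult_archimedean_def
proof (intro allI impI)
  interpret totally_preordered_semifield le by fact
  fix x y :: 'a assume x: "x \<noteq> 0" and y: "y \<noteq> 0" and "\<forall>k. le\<inverse>\<inverse> (x ^ k) y"
  then have le: "le y (x ^ k)" for k by simp
  obtain x' y' where inv: "x * x' = 1" "y * y' = 1" using inverse_exists x y by blast
  have "le (x' ^ k) y'" for k
  proof -
    have "x ^ k * x' ^ k = 1" using inv(1) by (metis power_mult_distrib power_one)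
    then have "x' ^ k * y' * x ^ k = y'" "x' ^ k * y' * y = x' ^ k"
      using inv(2) by (metis mult.assoc mult.commute mult_1)+
    then show ?thesis using mult_mono[OF le, of "x' ^ k * y'" k] by simp
  qed
  moreover have "x' \<noteq> 0" "y' \<noteq> 0" using inv by auto
  ultimately have "le x' 1" using arch unfolding mult_archimedean_def by blast
  then have "le 1 x" using mult_mono[of x' 1 x] inv(1) by simp
  then show "le\<inverse>\<inverse> x 1" by simp
qed

text \<open>The same map witnesses both sides.\<close>

lemma equivalent_to_conversep:
  "equivalent_to leF\<inverse>\<inverse> leK \<longleftrightarrow> equivalent_to leF leK\<inverse>\<inverse>"
proof -
  have "(semiring_hom f \<and> monotone leF\<inverse>\<inverse> leK f \<and> (\<forall>x y. leF\<inverse>\<inverse> x y \<longleftrightarrow> leK (f x) (f y)) \<and>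
        (\<forall>y. \<exists>x. equiv_of leK (f x) y)) \<longleftrightarrow>
      (semiring_hom f \<and> monotone leF leK\<inverse>\<inverse> f \<and> (\<forall>x y. leF x y \<longleftrightarrow> leK\<inverse>\<inverse> (f x) (f y)) \<and>
        (\<forall>y. \<exists>x. equiv_of leK\<inverse>\<inverse> (f x) y))" for f
    unfolding monotone_def equiv_of_def conversep_iff by blast
  then show ?thesis unfolding equivalent_to_def by simp
qed

theorem theorem4p5:
  fixes le :: "'a::comm_semiring_1 \<Rightarrow> 'a \<Rightarrow> bool"
  assumes "totally_preordered_semifield le"
    and "mult_archimedean le"
  shows "(le 0 1 \<and> dedekind_complete le \<longrightarrow>
           exactly_one
             [equivalent_to le ((\<le>) :: nnreal \<Rightarrow> nnreal \<Rightarrow> bool),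
              equivalent_to le ((\<le>) :: boolsf \<Rightarrow> boolsf \<Rightarrow> bool),
              equivalent_to le ((\<le>) :: trop_int \<Rightarrow> trop_int \<Rightarrow> bool),
              equivalent_to le ((\<le>) :: trop_real \<Rightarrow> trop_real \<Rightarrow> bool)]) \<and>
         (le 1 0 \<and> dedekind_complete le\<inverse>\<inverse> \<longrightarrow>
           exactly_one
             [equivalent_to le ((\<le>)\<inverse>\<inverse> :: nnreal \<Rightarrow> nnreal \<Rightarrow> bool),
              equivalent_to le ((\<le>)\<inverse>\<inverse> :: boolsf \<Rightarrow> boolsf \<Rightarrow> bool),
              equivalent_to le ((\<le>)\<inverse>\<inverse> :: trop_int \<Rightarrow> trop_int \<Rightarrow> bool),
              equivalent_to le ((\<le>)\<inverse>\<inverse> :: trop_real \<Rightarrow> trop_real \<Rightarrow> bool)])"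
proof (intro conjI impI)
  assume le: "le 0 1 \<and> dedekind_complete le"
  interpret totally_preordered_semifield le by fact
  interpret archimedean_semifield le by unfold_locales (use le assms in auto)
  show "exactly_one
      [equivalent_to le ((\<le>) :: nnreal \<Rightarrow> nnreal \<Rightarrow> bool),
       equivalent_to le ((\<le>) :: boolsf \<Rightarrow> boolsf \<Rightarrow> bool),
       equivalent_to le ((\<le>) :: trop_int \<Rightarrow> trop_int \<Rightarrow> bool),
       equivalent_to le ((\<le>) :: trop_real \<Rightarrow> trop_real \<Rightarrow> bool)]"
    using exactly_one_model le by blast
next
  assume le: "le 1 0 \<and> dedekind_complete le\<inverse>\<inverse>"
  interpret op: totally_preordered_semifield "le\<inverse>\<inverse>"
    using totally_preordered_semifield_conversep assms(1) .
  interpret op: archimedean_semifield "le\<inverse>\<inverse>"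
    by unfold_locales (use le mult_archimedean_conversep assms in auto)
  show "exactly_one
      [equivalent_to le ((\<le>)\<inverse>\<inverse> :: nnreal \<Rightarrow> nnreal \<Rightarrow> bool),
       equivalent_to le ((\<le>)\<inverse>\<inverse> :: boolsf \<Rightarrow> boolsf \<Rightarrow> bool),
       equivalent_to le ((\<le>)\<inverse>\<inverse> :: trop_int \<Rightarrow> trop_int \<Rightarrow> bool),
       equivalent_to le ((\<le>)\<inverse>\<inverse> :: trop_real \<Rightarrow> trop_real \<Rightarrow> bool)]"
    using op.exactly_one_model le by (simp only: equivalent_to_conversep)
qed

end
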